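(* Let $k>1$ be real and let $t\in\mathbb{Z}$ with $t>-\lceil k/(k-1)\rceil$. Let $m_1,m_2\in\mathbb{N}$, $a_1,\dots,a_{m_1}\in\mathbb{R}$, $b_1,\dots,b_{m_2}\in\mathbb{R}_{\ge 0}$, let $r\ge 0$ be a real number with $r\ge (t+1)(k-1)/k$, and let $X_0$, $X_1$, $Y_r$ be constants with the properties described in the context. Put $X_2=\max\{X_0,\,kX_1,\,kY_r\}$. Then $$R_n^{(k)} > p_{\lceil kn/(k-1)\rceil+t}$$ for every $n\in\mathbb{N}$ with $$n\ge n_0=\frac{k-1}{k}\bigl(\pi(X_2)-t+1\bigr).$$
   Context: $\mathbb{N}$ is the set of positive integers, $p_n$ is the $n$th prime number, and $\pi(x)$ is the number of primes $\le x$. For real $k>1$ and $n\in\mathbb{N}$, the $n$th $k$-Ramanujan prime is $R_n^{(k)}=\min\{m\in\mathbb{N} : \pi(x)-\pi(x/k)\ge n \text{ for every real } x\ge m\}$. Put $A(x)=\sum_{j=1}^{m_1} a_j/\log^j x$ and $B(x)=\sum_{j=1}^{m_2} b_j/\log^j x$. The constants $Y_r,X_0,X_1>1$ are real numbers such that the following inequalities are defined (in particular, denominators are nonzero) and hold: (a) $\pi(x)>\dfrac{x}{\log x-1-A(x)}+r$ for every $x\ge Y_r$; (b) $\pi(x)<\dfrac{x}{\log x-1-B(x)}$ for every $x\ge X_0$; (c) $\log k-B(kx)+A(x)\ge 0$ for every $x\ge X_1$. *)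

theory Defs
  imports Complex_Main "HOL-Library.Infinite_Set" "HOL-Computational_Algebra.Primes"
begin

definition prime_pi :: "real \<Rightarrow> nat" where
  "prime_pi x = card {p::nat. prime p \<and> real p \<le> x}"

text \<open>\<open>enumerate\<close> counts from 0, whereas \<open>nth_prime 1 = 2\<close>; the value at 0 is meaningless.\<close>

definition nth_prime :: "nat \<Rightarrow> nat" where
  "nth_prime n = enumerate {p::nat. prime p} (n - 1)"

text \<open>The generalized Ramanujan prime is meant for \<open>k > 1\<close> and \<open>n \<ge> 1\<close>. The difference is taken
  in the integers and \<open>x\<close> ranges over the reals.\<close>

definition ramanujan_prime :: "real \<Rightarrow> nat \<Rightarrow> nat" where
  "ramanujan_prime k n =
     (LEAST m::nat. m \<ge> 1 \<and> (\<forall>x::real. x \<ge> real m \<longrightarrow> int (prime_pi x) - int (prime_pi (x / k)) \<ge> int n))"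

definition inv_log_sum :: "nat \<Rightarrow> (nat \<Rightarrow> real) \<Rightarrow> real \<Rightarrow> real" where
  "inv_log_sum m c x = (\<Sum>j=1..m. c j / ln x ^ j)"

end

theory Submission
  imports Defs "HOL-Real_Asymp.Real_Asymp"
begin

text \<open>
  Let \<open>N = \<lceil>k n / (k - 1)\<rceil> + t\<close> and let \<open>p\<close> be the \<open>N\<close>-th prime. The Ramanujan prime exceeds \<open>p\<close> as soon
  as the inequality that defines it fails at \<open>x = p\<close>, that is, as soon as \<open>\<pi>(p) - \<pi>(p/k) < n\<close>.
  Write \<open>D\<^sub>A(x) = ln x - 1 - A(x)\<close> and \<open>D\<^sub>B(x) = ln x - 1 - B(x)\<close>. The threshold \<open>n\<^sub>0\<close> is chosen so that
  \<open>N > \<pi>(X\<^sub>2)\<close>, hence \<open>p > X\<^sub>2\<close> and all three estimates are available: (a) and (c) at \<open>p/k\<close>, (b) at \<open>p\<close>.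
  Condition (c) says precisely that \<open>D\<^sub>A(p/k) \<le> D\<^sub>B(p)\<close>, so
  \<open>\<pi>(p/k) > (p/k) / D\<^sub>A(p/k) + r \<ge> (p / D\<^sub>B(p)) / k + r > \<pi>(p) / k + r = N/k + r\<close>.
  Since \<open>N < k n / (k - 1) + t + 1\<close>, the lower bound on \<open>r\<close> gives \<open>N (k - 1) / k < n + r\<close>, which
  turns this into \<open>\<pi>(p/k) > N - n\<close>.

  Two points need an argument of their own. The middle inequality requires \<open>D\<^sub>A > 0\<close>, while the
  hypothesis only says \<open>D\<^sub>A \<noteq> 0\<close>; positivity follows because \<open>D\<^sub>A\<close> is continuous and without zeros on \<open>[Y\<^sub>r, \<infinity>)\<close> and
  tends to infinity (\<open>ln_minus_inv_log_sum_pos\<close>). Moreover the minimum defining the Ramanujan prime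
  must be attained at all, that is, \<open>\<pi>(x) - \<pi>(x/k)\<close> must tend to infinity. For \<open>k\<close> close to 1 this is
  beyond Chebyshev's classical bounds, but here it follows from (a) and (b), which squeeze
  \<open>\<pi>(x) ln x / x\<close> to the limit 1 (\<open>prime_pi_asymp\<close>, \<open>prime_pi_diff_at_top\<close>).
\<close>

section \<open>The prime counting function\<close>

lemma finite_primes_le: "finite {p::nat. prime p \<and> real p \<le> x}"
proof (rule finite_subset)
  show "{p::nat. prime p \<and> real p \<le> x} \<subseteq> {..nat \<lfloor>x\<rfloor>}"
    by (auto simp: le_nat_floor)
qed simp

lemma prime_pi_mono: "x \<le> y \<Longrightarrow> prime_pi x \<le> prime_pi y"
  unfolding prime_pi_def by (rule card_mono[OF finite_primes_le]) auto

lemma prime_pi_nth_prime: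
  assumes "N \<ge> 1"
  shows "prime_pi (real (nth_prime N)) = N"
proof -
  let ?S = "{p::nat. prime p}"
  have "{p. prime p \<and> real p \<le> real (nth_prime N)} = enumerate ?S ` {..<N}" (is "?L = ?R")
  proof
    show "?L \<subseteq> ?R"
    proof
      fix p assume p: "p \<in> ?L"
      then obtain i where i: "p = enumerate ?S i"
        using enumerate_Ex[of ?S p] primes_infinite by auto
      with p have "i \<le> N - 1"
        using enumerate_mono_le_iff[OF primes_infinite, of i "N - 1"] by (simp add: nth_prime_def)
      then show "p \<in> ?R"
        using i assms by auto
    qed
    show "?R \<subseteq> ?L"
      using enumerate_in_set[OF primes_infinite] enumerate_mono_le_iff[OF primes_infinite]
      by (auto simp: nth_prime_def)
  qed
  moreover have "inj_on (enumerate ?S) {..<N}"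
    using inj_enumerate[OF primes_infinite] inj_on_subset by blast
  ultimately show ?thesis
    by (simp add: prime_pi_def card_image)
qed

section \<open>The denominators in the estimates\<close>

lemma inv_log_sum_tendsto_0: "(inv_log_sum m c \<longlongrightarrow> 0) at_top"
proof -
  have "((\<lambda>x. \<Sum>j=1..m. c j / ln x ^ j) \<longlongrightarrow> (\<Sum>j=1..m. 0)) at_top"
  proof (rule tendsto_sum)
    fix j assume "j \<in> {1..m}"
    then have "filterlim (\<lambda>x::real. ln x ^ j) at_top at_top"
      by (intro filterlim_pow_at_top ln_at_top) auto
    then show "((\<lambda>x. c j / ln x ^ j) \<longlongrightarrow> 0) at_top"
      by (intro real_tendsto_divide_at_top[OF tendsto_const])
  qed
  then show ?thesis
    by (simp add: inv_log_sum_def[abs_def])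
qed

lemma ln_minus_inv_log_sum_at_top:
  "filterlim (\<lambda>x. ln x - 1 - inv_log_sum m c x) at_top at_top"
proof -
  have "((\<lambda>x. - 1 - inv_log_sum m c x) \<longlongrightarrow> - 1 - 0) at_top"
    by (intro tendsto_intros inv_log_sum_tendsto_0)
  from filterlim_tendsto_add_at_top[OF this ln_at_top] show ?thesis
    by (simp add: algebra_simps)
qed

text \<open>The expression is eventually positive, so a negative value at \<open>y\<close> would force a zero beyond \<open>y\<close> by
  the intermediate value theorem.\<close>

lemma ln_minus_inv_log_sum_pos:
  assumes "y > 1" and nz: "\<And>x. x \<ge> y \<Longrightarrow> ln x - 1 - inv_log_sum m c x \<noteq> 0"
  shows "ln y - 1 - inv_log_sum m c y > 0"
proof (rule ccontr)
  assume "\<not> ?thesis"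
  then have neg: "ln y - 1 - inv_log_sum m c y \<le> 0" by simp
  have "eventually (\<lambda>x. ln x - 1 - inv_log_sum m c x \<ge> 0 \<and> x \<ge> y) at_top"
    using ln_minus_inv_log_sum_at_top[of m c, unfolded filterlim_at_top, rule_format, of 0]
      eventually_ge_at_top[of y]
    by (rule eventually_conj)
  then obtain z where z: "ln z - 1 - inv_log_sum m c z \<ge> 0" "z \<ge> y"
    by (metis (mono_tags, lifting) eventually_at_top_linorder order_refl)
  have "continuous_on {y..z} (\<lambda>x. ln x - 1 - inv_log_sum m c x)"
    unfolding inv_log_sum_def using assms(1) by (intro continuous_intros) auto
  from IVT'[OF neg z(1) z(2) this] obtain x where
    "y \<le> x" "ln x - 1 - inv_log_sum m c x = 0" by auto
  with nz show False by blast
qed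

lemma ln_over_ln_minus_inv_log_sum_tendsto_1:
  "((\<lambda>x. ln x / (ln x - 1 - inv_log_sum m c x)) \<longlongrightarrow> 1) at_top"
proof -
  have "((\<lambda>x. 1 / (1 - (1 + inv_log_sum m c x) / ln x)) \<longlongrightarrow> 1 / (1 - 0)) at_top"
    by (intro tendsto_intros real_tendsto_divide_at_top[where c = "1 + 0"]
        inv_log_sum_tendsto_0 ln_at_top) simp
  moreover have "eventually (\<lambda>x. 1 / (1 - (1 + inv_log_sum m c x) / ln x)
      = ln x / (ln x - 1 - inv_log_sum m c x)) at_top"
    using eventually_gt_at_top[of 1]
  proof eventually_elim
    case (elim x)
    then have "1 - (1 + inv_log_sum m c x) / ln x = (ln x - 1 - inv_log_sum m c x) / ln x"
      by (simp add: field_simps)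
    then show ?case by simp
  qed
  ultimately show ?thesis
    using tendsto_cong by force
qed

section \<open>Existence of the Ramanujan primes\<close>

text \<open>The corrections \<open>A\<close> and \<open>B\<close> vanish at infinity, so both estimates have the main term
  \<open>x / ln x\<close>.\<close>

lemma prime_pi_asymp:
  assumes lower: "\<And>x. x \<ge> Y \<Longrightarrow> real (prime_pi x) > x / (ln x - 1 - inv_log_sum m1 a x)"
    and upper: "\<And>x. x \<ge> X \<Longrightarrow> real (prime_pi x) < x / (ln x - 1 - inv_log_sum m2 b x)"
  shows "((\<lambda>x. real (prime_pi x) * ln x / x) \<longlongrightarrow> 1) at_top"
proof (rule tendsto_sandwich[OF _ _ ln_over_ln_minus_inv_log_sum_tendsto_1[of m1 a]
      ln_over_ln_minus_inv_log_sum_tendsto_1[of m2 b]])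
  have scale: "v * (ln x / x) = ln x / D" if "v = x / D" "x > 1" for v x D :: real
    using that by simp
  show "eventually (\<lambda>x. ln x / (ln x - 1 - inv_log_sum m1 a x)
      \<le> real (prime_pi x) * ln x / x) at_top"
    using eventually_ge_at_top[of Y] eventually_gt_at_top[of 1]
  proof eventually_elim
    case (elim x)
    then have "x / (ln x - 1 - inv_log_sum m1 a x) * (ln x / x) \<le> real (prime_pi x) * (ln x / x)"
      using lower[of x] by (intro mult_right_mono) auto
    with scale[OF refl elim(2)] show ?case by simp
  qed
  show "eventually (\<lambda>x. real (prime_pi x) * ln x / x
      \<le> ln x / (ln x - 1 - inv_log_sum m2 b x)) at_top"
    using eventually_ge_at_top[of X] eventually_gt_at_top[of 1]
  proof eventually_elim
    case (elim x)
    then have "real (prime_pi x) * (ln x / x) \<le> x / (ln x - 1 - inv_log_sum m2 b x) * (ln x / x)"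
      using upper[of x] by (intro mult_right_mono) auto
    with scale[OF refl elim(2)] show ?case by simp
  qed
qed

text \<open>The difference is asymptotic to \<open>(1 - 1/k) x / ln x\<close>, because \<open>ln (x/k)\<close> is asymptotic to \<open>ln x\<close>.\<close>

lemma prime_pi_diff_at_top:
  assumes "k > 1" and pnt: "((\<lambda>x. real (prime_pi x) * ln x / x) \<longlongrightarrow> 1) at_top"
  shows "filterlim (\<lambda>x. real (prime_pi x) - real (prime_pi (x / k))) at_top at_top"
proof -
  let ?g = "\<lambda>x. real (prime_pi x) * ln x / x"
  have "filterlim (\<lambda>x. x / k) at_top at_top"
    using assms(1) by real_asymp
  then have "((\<lambda>x. ?g (x / k)) \<longlongrightarrow> 1) at_top"
    by (rule filterlim_compose[OF pnt])
  moreover have "((\<lambda>x. ln x / ln (x / k)) \<longlongrightarrow> 1) at_top"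
    using assms(1) by real_asymp
  ultimately have "((\<lambda>x. ?g x - ?g (x / k) * (ln x / ln (x / k)) / k) \<longlongrightarrow> 1 - 1 * 1 / k) at_top"
    using assms(1) by (intro tendsto_intros pnt) auto
  moreover have "filterlim (\<lambda>x::real. x / ln x) at_top at_top"
    by real_asymp
  ultimately have "filterlim (\<lambda>x. (?g x - ?g (x / k) * (ln x / ln (x / k)) / k) * (x / ln x))
      at_top at_top"
    using assms(1) by (intro filterlim_tendsto_pos_mult_at_top) auto
  moreover have "eventually (\<lambda>x. (?g x - ?g (x / k) * (ln x / ln (x / k)) / k) * (x / ln x)
      = real (prime_pi x) - real (prime_pi (x / k))) at_top"
    using eventually_gt_at_top[of k]
  proof eventually_elim
    case (elim x)
    then have "x > 0" "ln x > 0" "ln (x / k) > 0"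
      using assms(1) by (auto intro!: ln_gt_zero)
    then show ?case
      using assms(1) by (simp add: field_simps)
  qed
  ultimately show ?thesis
    using filterlim_cong[OF refl refl] by force
qed

text \<open>One failure at \<open>x = p\<close> rules out every \<open>m \<le> p\<close>. The limit guarantees that some \<open>m\<close> is admissible;
  otherwise the least one would be an unspecified number.\<close>

lemma ramanujan_prime_greaterI:
  assumes lim: "filterlim (\<lambda>x. real (prime_pi x) - real (prime_pi (x / k))) at_top at_top"
    and fail: "real (prime_pi (real p)) - real (prime_pi (real p / k)) < real n"
  shows "ramanujan_prime k n > p"
proof -
  let ?P = "\<lambda>m::nat. m \<ge> 1 \<and>
    (\<forall>x::real. x \<ge> real m \<longrightarrow> int (prime_pi x) - int (prime_pi (x / k)) \<ge> int n)"
  obtain M where M: "\<And>x. x \<ge> M \<Longrightarrow> real n \<le> real (prime_pi x) - real (prime_pi (x / k))"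
    using lim by (metis (mono_tags, lifting) filterlim_at_top eventually_at_top_linorder)
  have "?P (max 1 (nat \<lceil>M\<rceil>))"
  proof (intro conjI allI impI)
    fix x :: real assume "x \<ge> real (max 1 (nat \<lceil>M\<rceil>))"
    then have "x \<ge> M" by linarith
    from M[OF this] show "int (prime_pi x) - int (prime_pi (x / k)) \<ge> int n" by linarith
  qed simp
  then have R: "?P (ramanujan_prime k n)"
    unfolding ramanujan_prime_def by (rule LeastI)
  show ?thesis
  proof (rule ccontr)
    assume "\<not> ?thesis"
    then have "int (prime_pi (real p)) - int (prime_pi (real p / k)) \<ge> int n"
      using R by simp
    with fail show False by linarith
  qed
qed

section \<open>The lower bound for Ramanujan primes\<close>

theorem theoremA:
  fixes k r X0 X1 Yr X2 n0 :: real and t :: int and m1 m2 n :: nat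
    and a b :: "nat \<Rightarrow> real"
  assumes "k > 1"
    and "t > - \<lceil>k / (k - 1)\<rceil>"
    and "m1 \<ge> 1" and "m2 \<ge> 1"
    and "\<And>j. j \<in> {1..m2} \<Longrightarrow> b j \<ge> 0"
    and "r \<ge> 0" and "r \<ge> (of_int t + 1) * (k - 1) / k"
    and "Yr > 1" and "X0 > 1" and "X1 > 1"
    and "\<And>x. x \<ge> Yr \<Longrightarrow> ln x - 1 - inv_log_sum m1 a x \<noteq> 0 \<and>
           real (prime_pi x) > x / (ln x - 1 - inv_log_sum m1 a x) + r"
    and "\<And>x. x \<ge> X0 \<Longrightarrow> ln x - 1 - inv_log_sum m2 b x \<noteq> 0 \<and>
           real (prime_pi x) < x / (ln x - 1 - inv_log_sum m2 b x)"
    and "\<And>x. x \<ge> X1 \<Longrightarrow> ln k - inv_log_sum m2 b (k * x) + inv_log_sum m1 a x \<ge> 0"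
    and "X2 = Max {X0, k * X1, k * Yr}"
    and "n0 = (k - 1) / k * (real (prime_pi X2) - of_int t + 1)"
    and "n \<ge> 1" and "real n \<ge> n0"
  shows "ramanujan_prime k n > nth_prime (nat (\<lceil>k * real n / (k - 1)\<rceil> + t))"
proof -
  define N where "N = nat (\<lceil>k * real n / (k - 1)\<rceil> + t)"
  define p where "p = real (nth_prime N)"
  have inv: "(k - 1) / k * (k * real n / (k - 1)) = real n" and pos: "(k - 1) / k > 0"
    using assms(1) by (auto simp: field_simps)
  have "real (prime_pi X2) - of_int t + 1 \<le> k * real n / (k - 1)"
    using assms(15,17) inv pos mult_le_cancel_left_pos by metis
  then have "real_of_int (\<lceil>k * real n / (k - 1)\<rceil> + t) \<ge> real (prime_pi X2) + 1"
    by linarith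
  then have Nceil: "int N = \<lceil>k * real n / (k - 1)\<rceil> + t" and Nge: "N > prime_pi X2"
    unfolding N_def by linarith+
  have pi_p: "prime_pi p = N"
    using Nge unfolding p_def by (intro prime_pi_nth_prime) simp
  then have "p > X2"
    using Nge prime_pi_mono[of p X2] by linarith
  then have "p > X0" "p > k * X1" "p > k * Yr"
    unfolding assms(14) by simp_all
  then have p_ge: "p \<ge> X0" "p / k \<ge> X1" "p / k \<ge> Yr"
    using assms(1) by (simp_all add: field_simps)
  let ?DA = "ln (p / k) - 1 - inv_log_sum m1 a (p / k)"
  let ?DB = "ln p - 1 - inv_log_sum m2 b p"
  have p_pos: "p > 0" using p_ge(1) assms(9) by linarith
  (* Only with a positive left-hand side does the comparison of denominators reverse to one of quotients. *)
  have "?DA > 0"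
    using p_ge(3) assms(8,11) by (intro ln_minus_inv_log_sum_pos) auto
  moreover have "?DA \<le> ?DB"
    using assms(13)[OF p_ge(2)] p_pos assms(1) by (simp add: ln_div)
  ultimately have "p / k / ?DA \<ge> p / k / ?DB"
    using p_pos assms(1) by (intro divide_left_mono) auto
  moreover have "real (prime_pi (p / k)) > p / k / ?DA + r"
    using assms(11)[OF p_ge(3)] by blast
  moreover have "p / k / ?DB > real N / k"
    using assms(12)[OF p_ge(1)] assms(1) divide_strict_right_mono[of "real N" "p / ?DB" k] pi_p
    by (simp add: mult.commute)
  ultimately have pi_pk: "real (prime_pi (p / k)) > real N / k + r" by linarith
  have "real N < k * real n / (k - 1) + (of_int t + 1)"
    using Nceil by linarith
  then have "(k - 1) / k * real N < (k - 1) / k * (k * real n / (k - 1) + (of_int t + 1))"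
    using pos by (rule mult_strict_left_mono)
  also have "\<dots> = real n + (of_int t + 1) * (k - 1) / k"
    using inv by (simp add: distrib_left mult.commute)
  also have "\<dots> \<le> real n + r"
    using assms(7) by simp
  finally have "real N - real N / k < real n + r"
    using assms(1) by (simp add: field_simps)
  with pi_pk have fail: "real (prime_pi p) - real (prime_pi (p / k)) < real n"
    unfolding pi_p by linarith
  have "((\<lambda>x. real (prime_pi x) * ln x / x) \<longlongrightarrow> 1) at_top"
  proof (rule prime_pi_asymp)
    show "real (prime_pi x) > x / (ln x - 1 - inv_log_sum m1 a x)" if "x \<ge> Yr" for x
      using assms(11)[OF that] assms(6) by linarith
    show "real (prime_pi x) < x / (ln x - 1 - inv_log_sum m2 b x)" if "x \<ge> X0" for x
      using assms(12)[OF that] by blast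
  qed
  from ramanujan_prime_greaterI[OF prime_pi_diff_at_top[OF assms(1) this] fail[unfolded p_def]]
  show ?thesis unfolding N_def .
qed

end
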